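(* Let $k\geq 2$ be an integer, let $\mathcal{R}$ be a commutative ring with identity, and let $\mathcal{G}=\begin{bmatrix} A & M\\ N & B\end{bmatrix}$ be a generalized matrix algebra over $\mathcal{R}$ such that $M$ is faithful as a left $A$-module and also as a right $B$-module. Let $\Theta$ be a $k$-commuting mapping of $\mathcal{G}$. Then $\Theta$ is of the form $$\Theta\left(\begin{bmatrix} a & m\\ n & b\end{bmatrix}\right)=\begin{bmatrix} \delta_1(a)+\delta_2(m)+\delta_3(n)+\delta_4(b) & \tau_2(m)\\ \nu_3(n) & \mu_1(a)+\mu_2(m)+\mu_3(n)+\mu_4(b)\end{bmatrix}$$ for all $\begin{bmatrix} a & m\\ n & b\end{bmatrix}\in\mathcal{G}$, where $$\delta_1\colon A\to A,\quad \delta_2\colon M\to\mathcal{Z}(A)_k,\quad \delta_3\colon N\to\mathcal{Z}(A)_k,\quad \delta_4\colon B\to\mathcal{Z}(A)_k,$$ $$\mu_1\colon A\to\mathcal{Z}(B)_k,\quad \mu_2\colon M\to\mathcal{Z}(B)_k,\quad \mu_3\colon N\to\mathcal{Z}(B)_k,\quad \mu_4\colon B\to B,$$ $$\tau_2\colon M\to M,\quad \nu_3\colon N\to N$$ are all $\mathcal{R}$-linear mappings satisfying the following conditions (for all $m\in M$, $n\in N$): (1) $\delta_1$ is a $k$-commuting mapping of $A$ and $\delta_1(1)\in\mathcal{Z}(A)_k$; (2) $\mu_4$ is a $k$-commuting mapping of $B$ and $\mu_4(1)\in\mathcal{Z}(B)_k$; (3) $(\delta_1(1)+\delta_4(1)+2\delta_2(m))m=m(\mu_1(1)+\mu_4(1)+2\mu_2(m))$;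 (4) $n(\delta_1(1)+\delta_4(1)+2\delta_3(n))=(\mu_1(1)+\mu_4(1)+2\mu_3(n))n$; (5) $2\tau_2(m)=(\delta_1(1)-\delta_4(1))m-m(\mu_1(1)-\mu_4(1))$; (6) $2\nu_3(n)=n(\delta_1(1)-\delta_4(1))-(\mu_1(1)-\mu_4(1))n$.
   Context: Generalized matrix algebra: let $\mathcal{R}$ be a commutative ring with identity, $A,B$ unital associative $\mathcal{R}$-algebras, $M$ an $(A,B)$-bimodule, $N$ a $(B,A)$-bimodule, together with bimodule homomorphisms $M\otimes_B N\to A$, $m\otimes n\mapsto mn$, and $N\otimes_A M\to B$, $n\otimes m\mapsto nm$, satisfying $(mn)m'=m(nm')$ and $(nm)n'=n(mn')$ for all $m,m'\in M$, $n,n'\in N$ (a Morita context). At least one of $M,N$ is nonzero. The set $\mathcal{G}$ of matrices $\begin{bmatrix} a & m\\ n & b\end{bmatrix}$ ($a\in A,m\in M,n\in N,b\in B$), with matrix-like addition and multiplication, is a unital associative $\mathcal{R}$-algebra called a generalized matrix algebra (of order 2). For an associative algebra $\mathcal{A}$: $[a,b]_0=a$, $[a,b]_1=ab-ba$, $[a,b]_k=[[a,b]_{k-1},b]$; $\mathcal{Z}(\mathcal{A})_k=\{a\in\mathcal{A}\mid [a,x]_k=0\ \forall x\in\mathcal{A}\}$ (an $\mathcal{R}$-submodule of $\mathcal{A}$). An $\mathcal{R}$-linear mapping $\Theta\colon\mathcal{A}\to\mathcal{A}$ is $k$-commuting if $[\Theta(a),a]_k=0$ for all $a\in\mathcal{A}$.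 The symbol $1$ denotes the identity of $A$ or of $B$, according to the domain of the map applied to it. *)

theory Defs
  imports Complex_Main "HOL-Library.Product_Plus"
begin

text \<open>
  Base ring, algebras and bimodules are carried by whole types. The classes
  \<^class>\<open>comm_ring_1\<close> and \<^class>\<open>ring_1\<close> exclude the zero ring; this loses no
  generalized matrix algebra, since one of the two (unital) bimodules is required to be
  nonzero, which forces both algebras and the base ring to be nonzero.
\<close>

locale unital_algebra = module scale
  for scale :: "'r::comm_ring_1 \<Rightarrow> 'a::ring_1 \<Rightarrow> 'a" +
  assumes scale_mult_left: "scale r x * y = scale r (x * y)"
    and scale_mult_right: "x * scale r y = scale r (x * y)"

text \<open>The last two axioms say that the base ring acts centrally, through either algebra.\<close>

locale bimodule =
  A: unital_algebra sA + B: unital_algebra sB + M: module sM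
  for sA :: "'r::comm_ring_1 \<Rightarrow> 'a::ring_1 \<Rightarrow> 'a"
    and sB :: "'r \<Rightarrow> 'b::ring_1 \<Rightarrow> 'b"
    and sM :: "'r \<Rightarrow> 'm::ab_group_add \<Rightarrow> 'm" +
  fixes l :: "'a \<Rightarrow> 'm \<Rightarrow> 'm"
    and r :: "'m \<Rightarrow> 'b \<Rightarrow> 'm"
  assumes l_add_right: "l a (m + m') = l a m + l a m'"
    and l_add_left: "l (a + a') m = l a m + l a' m"
    and l_mult: "l (a * a') m = l a (l a' m)"
    and l_one: "l 1 m = m"
    and r_add_left: "r (m + m') b = r m b + r m' b"
    and r_add_right: "r m (b + b') = r m b + r m b'"
    and r_mult: "r m (b * b') = r (r m b) b'"
    and r_one: "r m 1 = m"
    and l_r: "r (l a m) b = l a (r m b)"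
    and l_scale: "l (sA c a) m = sM c (l a m)"
    and r_scale: "r m (sB c b) = sM c (r m b)"

definition faithful_left :: "('a::zero \<Rightarrow> 'm::zero \<Rightarrow> 'm) \<Rightarrow> bool" where
  "faithful_left l \<longleftrightarrow> (\<forall>a. (\<forall>m. l a m = 0) \<longrightarrow> a = 0)"

definition faithful_right :: "('m::zero \<Rightarrow> 'b::zero \<Rightarrow> 'm) \<Rightarrow> bool" where
  "faithful_right r \<longleftrightarrow> (\<forall>b. (\<forall>m. r m b = 0) \<longrightarrow> b = 0)"

text \<open>
  A bimodule homomorphism from the tensor product over \<open>B\<close> of an \<open>(A,B)\<close>-bimodule and a
  \<open>(B,A)\<close>-bimodule to \<open>A\<close>, given by its values on pure tensors: a biadditive,
  \<open>B\<close>-balanced map that is left and right \<open>A\<close>-linear.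
\<close>

definition bimodule_pairing ::
  "('a::ring_1 \<Rightarrow> 'm::ab_group_add \<Rightarrow> 'm) \<Rightarrow> ('m \<Rightarrow> 'b::ring_1 \<Rightarrow> 'm) \<Rightarrow>
   ('b \<Rightarrow> 'n::ab_group_add \<Rightarrow> 'n) \<Rightarrow> ('n \<Rightarrow> 'a \<Rightarrow> 'n) \<Rightarrow> ('m \<Rightarrow> 'n \<Rightarrow> 'a) \<Rightarrow> bool" where
  "bimodule_pairing lM rM lN rN p \<longleftrightarrow>
     (\<forall>m m' n. p (m + m') n = p m n + p m' n) \<and>
     (\<forall>m n n'. p m (n + n') = p m n + p m n') \<and>
     (\<forall>m b n. p (rM m b) n = p m (lN b n)) \<and>
     (\<forall>a m n. p (lM a m) n = a * p m n) \<and>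
     (\<forall>m n a. p m (rN n a) = p m n * a)"

locale morita_context =
  M: bimodule sA sB sM lM rM + N: bimodule sB sA sN lN rN
  for sA :: "'r::comm_ring_1 \<Rightarrow> 'a::ring_1 \<Rightarrow> 'a"
    and sB :: "'r \<Rightarrow> 'b::ring_1 \<Rightarrow> 'b"
    and sM :: "'r \<Rightarrow> 'm::ab_group_add \<Rightarrow> 'm"
    and sN :: "'r \<Rightarrow> 'n::ab_group_add \<Rightarrow> 'n"
    and lM :: "'a \<Rightarrow> 'm \<Rightarrow> 'm"
    and rM :: "'m \<Rightarrow> 'b \<Rightarrow> 'm"
    and lN :: "'b \<Rightarrow> 'n \<Rightarrow> 'n"
    and rN :: "'n \<Rightarrow> 'a \<Rightarrow> 'n" +
  fixes MN :: "'m \<Rightarrow> 'n \<Rightarrow> 'a"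
    and NM :: "'n \<Rightarrow> 'm \<Rightarrow> 'b"
  assumes MN_pairing: "bimodule_pairing lM rM lN rN MN"
    and NM_pairing: "bimodule_pairing lN rN lM rM NM"
    and MN_NM: "lM (MN m n) m' = rM m (NM n m')"
    and NM_MN: "lN (NM n m) n' = rN n (MN m n')"

locale generalized_matrix_algebra = morita_context sA sB sM sN lM rM lN rN MN NM
  for sA :: "'r::comm_ring_1 \<Rightarrow> 'a::ring_1 \<Rightarrow> 'a"
    and sB :: "'r \<Rightarrow> 'b::ring_1 \<Rightarrow> 'b"
    and sM :: "'r \<Rightarrow> 'm::ab_group_add \<Rightarrow> 'm"
    and sN :: "'r \<Rightarrow> 'n::ab_group_add \<Rightarrow> 'n"
    and lM rM lN rN MN NM +
  assumes nonzero: "(\<exists>m::'m. m \<noteq> 0) \<or> (\<exists>n::'n. n \<noteq> 0)"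

text \<open>
  The matrix with rows \<open>a m\<close> and \<open>n b\<close> is represented by the tuple \<open>(a, m, n, b)\<close>;
  addition is the componentwise addition of tuples.
\<close>

fun gm_mult ::
  "('a::ring_1 \<Rightarrow> 'm::ab_group_add \<Rightarrow> 'm) \<Rightarrow> ('m \<Rightarrow> 'b::ring_1 \<Rightarrow> 'm) \<Rightarrow>
   ('b \<Rightarrow> 'n::ab_group_add \<Rightarrow> 'n) \<Rightarrow> ('n \<Rightarrow> 'a \<Rightarrow> 'n) \<Rightarrow> ('m \<Rightarrow> 'n \<Rightarrow> 'a) \<Rightarrow> ('n \<Rightarrow> 'm \<Rightarrow> 'b) \<Rightarrow>
   'a \<times> 'm \<times> 'n \<times> 'b \<Rightarrow> 'a \<times> 'm \<times> 'n \<times> 'b \<Rightarrow> 'a \<times> 'm \<times> 'n \<times> 'b" where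
  "gm_mult lM rM lN rN MN NM (a, m, n, b) (a', m', n', b') =
     (a * a' + MN m n', lM a m' + rM m b', rN n a' + lN b n', NM n m' + b * b')"

fun gm_scale ::
  "('r \<Rightarrow> 'a \<Rightarrow> 'a) \<Rightarrow> ('r \<Rightarrow> 'm \<Rightarrow> 'm) \<Rightarrow> ('r \<Rightarrow> 'n \<Rightarrow> 'n) \<Rightarrow> ('r \<Rightarrow> 'b \<Rightarrow> 'b) \<Rightarrow>
   'r \<Rightarrow> 'a \<times> 'm \<times> 'n \<times> 'b \<Rightarrow> 'a \<times> 'm \<times> 'n \<times> 'b" where
  "gm_scale sA sM sN sB c (a, m, n, b) = (sA c a, sM c m, sN c n, sB c b)"

text \<open>
  The product is an explicit argument below, because the product of a generalized matrix
  algebra depends on the Morita context and is not a class operation.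
\<close>

fun iter_comm :: "('x \<Rightarrow> 'x \<Rightarrow> 'x::ab_group_add) \<Rightarrow> nat \<Rightarrow> 'x \<Rightarrow> 'x \<Rightarrow> 'x" where
  "iter_comm f 0 a b = a"
| "iter_comm f (Suc k) a b = f (iter_comm f k a b) b - f b (iter_comm f k a b)"

definition k_center :: "('x \<Rightarrow> 'x \<Rightarrow> 'x::ab_group_add) \<Rightarrow> nat \<Rightarrow> 'x set" where
  "k_center f k = {a. \<forall>x. iter_comm f k a x = 0}"

definition k_commuting ::
  "('r::comm_ring_1 \<Rightarrow> 'x \<Rightarrow> 'x) \<Rightarrow> ('x \<Rightarrow> 'x \<Rightarrow> 'x::ab_group_add) \<Rightarrow> nat \<Rightarrow> ('x \<Rightarrow> 'x) \<Rightarrow> bool"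
  where
  "k_commuting s f k \<Theta> \<longleftrightarrow> module_hom s s \<Theta> \<and> (\<forall>a. iter_comm f k (\<Theta> a) a = 0)"

context morita_context
begin

lemma pairing_simps:
  "MN (m + m') n = MN m n + MN m' n" "MN m (n + n') = MN m n + MN m n'"
  "MN (rM m b) n = MN m (lN b n)" "MN (lM a m) n = a * MN m n" "MN m (rN n a) = MN m n * a"
  "NM (n + n') m = NM n m + NM n' m" "NM n (m + m') = NM n m + NM n m'"
  "NM (rN n a) m = NM n (lM a m)" "NM (lN b n) m = b * NM n m" "NM n (rM m b) = NM n m * b"
  using MN_pairing NM_pairing unfolding bimodule_pairing_def by simp_all

abbreviation gmul (infixl \<open>\<odot>\<close> 70) where "gmul \<equiv> gm_mult lM rM lN rN MN NM"

abbreviation gscale where "gscale \<equiv> gm_scale sA sM sN sB"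

lemmas action_simps =
  M.l_add_right M.l_add_left M.l_mult M.r_add_left M.r_add_right M.r_mult M.l_r
  N.l_add_right N.l_add_left N.l_mult N.r_add_left N.r_add_right N.r_mult N.l_r

lemma action_zero [simp]:
  "lM a 0 = 0" "lM 0 m = 0" "rM 0 b = 0" "rM m 0 = 0"
  "lN b 0 = 0" "lN 0 n = 0" "rN 0 a = 0" "rN n 0 = 0"
  "MN 0 n = 0" "MN m 0 = 0" "NM 0 m = 0" "NM n 0 = 0"
  using M.l_add_right[of a 0 0] M.l_add_left[of 0 0 m] M.r_add_left[of 0 0 b]
    M.r_add_right[of m 0 0] N.l_add_right[of b 0 0] N.l_add_left[of 0 0 n]
    N.r_add_left[of 0 0 a] N.r_add_right[of n 0 0]
    pairing_simps(1)[of 0 0 n] pairing_simps(2)[of m 0 0]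
    pairing_simps(6)[of 0 0 m] pairing_simps(7)[of n 0 0]
  by simp_all

lemma gmul_assoc: "(x \<odot> y) \<odot> z = x \<odot> (y \<odot> z)"
  by (cases x; cases y; cases z)
    (simp add: action_simps pairing_simps MN_NM NM_MN algebra_simps)

lemma gmul_distrib_right: "(x + y) \<odot> z = x \<odot> z + y \<odot> z"
  by (cases x; cases y; cases z) (simp add: action_simps pairing_simps algebra_simps)

lemma gmul_distrib_left: "x \<odot> (y + z) = x \<odot> y + x \<odot> z"
  by (cases x; cases y; cases z) (simp add: action_simps pairing_simps algebra_simps)

lemma gmul_one: "(1, 0, 0, 1) \<odot> x = x" "x \<odot> (1, 0, 0, 1) = x"
  by (cases x; simp add: M.l_one M.r_one N.l_one N.r_one)+

lemma action_scale:
  "lM a (sM c m) = sM c (lM a m)" "rM (sM c m) b = sM c (rM m b)"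
  "lN b (sN c n) = sN c (lN b n)" "rN (sN c n) a = sN c (rN n a)"
  "MN (sM c m) n = sA c (MN m n)" "MN m (sN c n) = sA c (MN m n)"
  "NM (sN c n) m = sB c (NM n m)" "NM n (sM c m) = sB c (NM n m)"
proof -
  have m: "sM c x = lM (sA c 1) x" "sM c x = rM x (sB c 1)" for c x
    by (simp_all add: M.l_scale M.l_one M.r_scale M.r_one)
  have n: "sN c x = lN (sB c 1) x" "sN c x = rN x (sA c 1)" for c x
    by (simp_all add: N.l_scale N.l_one N.r_scale N.r_one)
  show "lM a (sM c m) = sM c (lM a m)" by (simp add: m(2) M.l_r)
  show "rM (sM c m) b = sM c (rM m b)" by (simp add: m(1) M.l_r)
  show "lN b (sN c n) = sN c (lN b n)" by (simp add: n(2) N.l_r)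
  show "rN (sN c n) a = sN c (rN n a)" by (simp add: n(1) N.l_r)
  show "MN (sM c m) n = sA c (MN m n)"
    by (simp add: m(1) pairing_simps M.A.scale_mult_left)
  show "MN m (sN c n) = sA c (MN m n)"
    by (simp add: n(2) pairing_simps M.A.scale_mult_right)
  show "NM (sN c n) m = sB c (NM n m)"
    by (simp add: n(1) pairing_simps M.B.scale_mult_left)
  show "NM n (sM c m) = sB c (NM n m)"
    by (simp add: m(2) pairing_simps M.B.scale_mult_right)
qed

lemma module_gscale: "module gscale"
  by unfold_locales
    (auto simp: M.A.scale_right_distrib M.B.scale_right_distrib M.M.scale_right_distrib
      N.M.scale_right_distrib M.A.scale_left_distrib M.B.scale_left_distrib
      M.M.scale_left_distrib N.M.scale_left_distrib)

lemma gmul_scale: "gscale c x \<odot> y = gscale c (x \<odot> y)" "x \<odot> gscale c y = gscale c (x \<odot> y)"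
  by (cases x; cases y; simp add: action_scale M.l_scale M.r_scale N.l_scale N.r_scale
      M.A.scale_mult_left M.A.scale_mult_right M.B.scale_mult_left M.B.scale_mult_right
      M.A.scale_right_distrib M.B.scale_right_distrib M.M.scale_right_distrib
      N.M.scale_right_distrib)+

end

end

theory Submission
  imports Defs
begin

text \<open>
  Write \<open>e = (1, 0, 0, 0)\<close> and \<open>f = (0, 0, 0, 1)\<close>. Evaluating the \<open>k\<close>-commuting identity at
  \<open>a\<close> and at \<open>a \<plusminus> 1\<close> shows that the off-diagonal entries of \<open>\<Theta> a\<close> are annihilated by powers
  of the coprime elements \<open>a\<close> and \<open>a \<plusminus> 1\<close>, hence vanish; likewise for \<open>b\<close>. For an idempotent
  \<open>x\<close> the commutator map \<open>y \<mapsto> [y, x]\<close> equals its own cube, so \<open>\<Theta> x\<close> honestly commutes with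
  \<open>x\<close>; at the idempotents \<open>e + m\<close>, \<open>f + m\<close>, \<open>e + n\<close>, \<open>f + n\<close> this gives the vanishing of the
  remaining off-diagonal entries and, by adding and subtracting, conditions (3)--(6).
  The centrality statements are the diagonal entries of the identity at triangular matrices.
\<close>

section \<open>Nilpotency of comaximal operators and of sign changes\<close>

text \<open>Induction on \<open>i + j\<close> replaces Bezout coefficients for the coprime
  polynomials \<open>X ^ i\<close> and \<open>(X + 1) ^ j\<close>: the vectors \<open>f t\<close>
  and \<open>f t + t\<close> each need one factor less, so both vanish, and \<open>t\<close> is
  their difference. If an exponent is 0, the corresponding premise is already
  \<open>t = 0\<close>.\<close>

lemma comaximal_funpow_zero:
  fixes f :: "'x::ab_group_add \<Rightarrow> 'x"
  assumes add: "\<And>x y. f (x + y) = f x + f y"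
    and "(f ^^ i) t = 0" and "((\<lambda>x. f x + x) ^^ j) t = 0"
  shows "t = 0"
  using assms(2,3)
proof (induction "i + j" arbitrary: i j t rule: less_induct)
  case less
  let ?g = "\<lambda>x. f x + x"
  have f0: "f 0 = 0" using add[of 0 0] by simp
  have comm: "f (?g x) = ?g (f x)" for x by (simp add: add)
  have fg: "(?g ^^ j) (f x) = f ((?g ^^ j) x)" for j x
    by (induction j arbitrary: x) (simp_all add: comm funpow_swap1)
  have gf: "(f ^^ i) (?g x) = ?g ((f ^^ i) x)" for i x
    by (induction i arbitrary: x) (simp_all add: add funpow_swap1)
  show ?case
  proof (cases "i = 0 \<or> j = 0")
    case True
    then show ?thesis using less.prems by auto
  next
    case False
    then obtain i' j' where ij: "i = Suc i'" "j = Suc j'" by (metis not0_implies_Suc)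
    have "(f ^^ i') (f t) = 0" "(?g ^^ j) (f t) = 0"
      using less.prems f0 unfolding fg by (simp_all add: ij funpow_swap1)
    then have "f t = 0" by (rule less.hyps[rotated]) (simp add: ij)
    have "(f ^^ i) (?g t) = 0" using less.prems(1) f0 unfolding gf by simp
    moreover have "(?g ^^ j') (?g t) = 0"
      using less.prems(2) unfolding ij funpow_Suc_right comp_apply .
    ultimately have "?g t = 0" by (rule less.hyps[rotated]) (simp add: ij)
    with \<open>f t = 0\<close> show ?thesis by simp
  qed
qed

text \<open>Serves the unit corners, where the operators on the off-diagonal entries are the
  identity or its negative.\<close>

lemma funpow_sign_zero:
  fixes t :: "'x::ab_group_add"
  assumes "(f ^^ k) t = 0" and f: "\<And>x. f x = x \<or> f x = - x"
  shows "t = 0"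
proof -
  have "(f ^^ k) t = t \<or> (f ^^ k) t = - t"
    by (induction k) (simp, metis f funpow.simps(2) comp_apply minus_minus)
  with assms(1) show ?thesis by (metis neg_equal_0_iff_equal)
qed

section \<open>Iterated commutators in a ring\<close>

lemma iter_comm_add:
  fixes x :: "'x::ring_1"
  shows "iter_comm (*) k (a + b) x = iter_comm (*) k a x + iter_comm (*) k b x"
  by (induction k) (simp_all add: algebra_simps)

lemma iter_comm_add_one:
  fixes x :: "'x::ring_1"
  shows "iter_comm (*) k a (x + 1) = iter_comm (*) k a x"
  by (induction k) (simp_all add: algebra_simps)

text \<open>Bracketing with \<open>x + 1\<close> is bracketing with \<open>x\<close>, because 1 is
  central. Subtracting the \<open>k\<close>-commuting identity at \<open>x\<close> from the one at
  \<open>x + 1\<close> therefore isolates the contribution of \<open>\<delta> 1\<close>.\<close>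

lemma k_commuting_one:
  fixes \<delta> :: "'x::ring_1 \<Rightarrow> 'x"
  assumes "k_commuting s (*) k \<delta>"
  shows "\<delta> 1 \<in> k_center (*) k"
  unfolding k_center_def
proof safe
  fix x
  interpret module_hom s s \<delta> using assms by (simp add: k_commuting_def)
  have "0 = iter_comm (*) k (\<delta> (x + 1)) (x + 1)"
    using assms by (simp add: k_commuting_def)
  also have "\<dots> = iter_comm (*) k (\<delta> x) x + iter_comm (*) k (\<delta> 1) x"
    by (simp only: add iter_comm_add iter_comm_add_one)
  finally show "iter_comm (*) k (\<delta> 1) x = 0"
    using assms by (simp add: k_commuting_def)
qed

section \<open>Iterated commutators in the generalized matrix algebra\<close>

context morita_context
begin

lemma action_minus [simp]:
  "lM a (- m) = - lM a m" "lM (- a) m = - lM a m" "rM (- m) b = - rM m b" "rM m (- b) = - rM m b"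
  "lN b (- n) = - lN b n" "lN (- b) n = - lN b n" "rN (- n) a = - rN n a" "rN n (- a) = - rN n a"
  using M.l_add_right[of a m "- m"] M.l_add_left[of a "- a" m] M.r_add_left[of m "- m" b]
    M.r_add_right[of m b "- b"] N.l_add_right[of b n "- n"] N.l_add_left[of b "- b" n]
    N.r_add_left[of n "- n" a] N.r_add_right[of n a "- a"]
  by (simp_all add: eq_neg_iff_add_eq_0 add.commute)

lemma action_diff:
  "lM (a - a') m = lM a m - lM a' m" "rM m (b - b') = rM m b - rM m b'"
  "lN (b - b') n = lN b n - lN b' n" "rN n (a - a') = rN n a - rN n a'"
  using M.l_add_left[of a "- a'" m] M.r_add_right[of m b "- b'"]
    N.l_add_left[of b "- b'" n] N.r_add_right[of n a "- a'"]
  by simp_all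

lemma gmul_diff_right: "(x - y) \<odot> z = x \<odot> z - y \<odot> z"
  using gmul_distrib_right[of "x - y" y z] by (simp add: algebra_simps)

lemma gmul_diff_left: "x \<odot> (y - z) = x \<odot> y - x \<odot> z"
  using gmul_distrib_left[of x "y - z" z] by (simp add: algebra_simps)

lemma gmul_zero: "0 \<odot> x = 0" "x \<odot> 0 = 0"
  using gmul_diff_right[of 0 0 x] gmul_diff_left[of x 0 0] by simp_all

text \<open>Left and right multiplication by \<open>x\<close> are commuting idempotent operators
  \<open>L\<close> and \<open>R\<close>, so \<open>(R - L)^3 = R - L\<close>.\<close>

lemma iter_comm_idempotent:
  assumes idem: "x \<odot> x = x"
  shows "iter_comm gmul (Suc (Suc (Suc j))) y x = iter_comm gmul (Suc j) y x"
proof -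
  have idem': "(z \<odot> x) \<odot> x = z \<odot> x" "x \<odot> (x \<odot> z) = x \<odot> z" for z
    using gmul_assoc[of z x x] gmul_assoc[of x x z] idem by simp_all
  show ?thesis
    \<comment> \<open>Reassociating only products with \<open>x\<close> on both outer sides brings
      every term to one of the shapes \<open>z x\<close>, \<open>x z\<close>,
      \<open>(x z) x\<close>, which then cancel.\<close>
    by (simp add: gmul_diff_right gmul_diff_left idem' gmul_assoc[of x _ x, symmetric])
qed

text \<open>Lowering the exponent in steps of two ends at a single bracket. The identity
  \<open>D^3 = D\<close> for the bracket \<open>D\<close> does not lower exponents below 1, so 0, 1
  and 2 are handled separately.\<close>

lemma idempotent_commute:
  assumes idem: "x \<odot> x = x" and "iter_comm gmul k y x = 0"
  shows "y \<odot> x = x \<odot> y"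
proof -
  have "iter_comm gmul (Suc 0) y x = 0"
    using assms(2)
  proof (induction k rule: less_induct)
    case (less k)
    consider "k = 0" | "k = 1" | "k = 2" | j where "k = Suc (Suc (Suc j))"
      by (metis One_nat_def not0_implies_Suc numeral_2_eq_2)
    then show ?case
    proof cases
      case 1
      then show ?thesis using less.prems by (simp add: gmul_zero)
    next
      case 2
      then show ?thesis using less.prems by simp
    next
      case 3
      \<comment> \<open>Exponent 2 is first raised to 3, by one more bracket of zero, and then
        lowered to 1.\<close>
      then have "iter_comm gmul (Suc (Suc (Suc 0))) y x = 0"
        using less.prems by (simp add: numeral_2_eq_2 gmul_zero)
      then show ?thesis by (simp only: iter_comm_idempotent[OF idem])
    next
      case 4
      then show ?thesis
        using less.IH[of "Suc j"] less.prems by (simp only: iter_comm_idempotent[OF idem])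
    qed
  qed
  then show ?thesis by simp
qed

text \<open>A corner element does not mix the four entries: the bracket acts on each by its own
  operator and kills the opposite diagonal entry at the first step, whence the case
  \<open>k = 0\<close>.\<close>

lemma iter_comm_corner_left:
  "iter_comm gmul k (\<alpha>, t, v, \<beta>) (a, 0, 0, 0) =
    (iter_comm (*) k \<alpha> a, ((\<lambda>t. - lM a t) ^^ k) t, ((\<lambda>v. rN v a) ^^ k) v, if k = 0 then \<beta> else 0)"
  by (induction k) simp_all

lemma iter_comm_corner_right:
  "iter_comm gmul k (\<alpha>, t, v, \<beta>) (0, 0, 0, b) =
    (if k = 0 then \<alpha> else 0, ((\<lambda>t. rM t b) ^^ k) t, ((\<lambda>v. - lN b v) ^^ k) v, iter_comm (*) k \<beta> b)"
  by (induction k) simp_all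

text \<open>Between upper triangular matrices both pairings contribute zero, so the diagonal evolves
  by ring commutators alone; the upper right entry is left unspecified.\<close>

lemma iter_comm_upper:
  "\<exists>s. iter_comm gmul k (\<alpha>, t, 0, \<beta>) (a, m, 0, b) =
    (iter_comm (*) k \<alpha> a, s, 0, iter_comm (*) k \<beta> b)"
  by (induction k) auto

lemma iter_comm_lower:
  "\<exists>s. iter_comm gmul k (\<alpha>, 0, t, \<beta>) (a, 0, n, b) =
    (iter_comm (*) k \<alpha> a, 0, s, iter_comm (*) k \<beta> b)"
  by (induction k) auto

lemma module_hom_injections:
  "module_hom sA gscale (\<lambda>a. (a, 0, 0, 0))" "module_hom sM gscale (\<lambda>m. (0, m, 0, 0))"
  "module_hom sN gscale (\<lambda>n. (0, 0, n, 0))" "module_hom sB gscale (\<lambda>b. (0, 0, 0, b))"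
  by (simp_all add: module_hom_def module_hom_axioms_def module_gscale
      M.A.module_axioms M.B.module_axioms M.M.module_axioms N.M.module_axioms)

lemma module_hom_projections:
  "module_hom gscale sA fst" "module_hom gscale sM (fst \<circ> snd)"
  "module_hom gscale sN (fst \<circ> snd \<circ> snd)" "module_hom gscale sB (snd \<circ> snd \<circ> snd)"
  by (auto simp: module_hom_def module_hom_axioms_def module_gscale
      M.A.module_axioms M.B.module_axioms M.M.module_axioms N.M.module_axioms)

end

section \<open>The entry maps of a \<open>k\<close>-commuting mapping\<close>

locale gm_k_commuting = morita_context sA sB sM sN lM rM lN rN MN NM
  for sA :: "'r::comm_ring_1 \<Rightarrow> 'a::ring_1 \<Rightarrow> 'a"
    and sB :: "'r \<Rightarrow> 'b::ring_1 \<Rightarrow> 'b"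
    and sM :: "'r \<Rightarrow> 'm::ab_group_add \<Rightarrow> 'm"
    and sN :: "'r \<Rightarrow> 'n::ab_group_add \<Rightarrow> 'n"
    and lM rM lN rN MN NM +
  fixes \<Theta> :: "'a \<times> 'm \<times> 'n \<times> 'b \<Rightarrow> 'a \<times> 'm \<times> 'n \<times> 'b" and k :: nat
  assumes comm: "k_commuting gscale gmul k \<Theta>"
begin

text \<open>The letter gives the entry that is read off (\<delta>, \<tau>, \<nu>, \<mu> for the
  \<open>A\<close>, \<open>M\<close>, \<open>N\<close>, \<open>B\<close> entries) and the index
  gives the entry that is fed in, in the same order. Written as compositions, the maps inherit
  linearity from injections and projections.\<close>

definition "\<delta>\<^sub>1 = fst \<circ> (\<Theta> \<circ> (\<lambda>a. (a, 0, 0, 0)))"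
definition "\<delta>\<^sub>2 = fst \<circ> (\<Theta> \<circ> (\<lambda>m. (0, m, 0, 0)))"
definition "\<delta>\<^sub>3 = fst \<circ> (\<Theta> \<circ> (\<lambda>n. (0, 0, n, 0)))"
definition "\<delta>\<^sub>4 = fst \<circ> (\<Theta> \<circ> (\<lambda>b. (0, 0, 0, b)))"
definition "\<tau>\<^sub>1 = (fst \<circ> snd) \<circ> (\<Theta> \<circ> (\<lambda>a. (a, 0, 0, 0)))"
definition "\<tau>\<^sub>2 = (fst \<circ> snd) \<circ> (\<Theta> \<circ> (\<lambda>m. (0, m, 0, 0)))"
definition "\<tau>\<^sub>3 = (fst \<circ> snd) \<circ> (\<Theta> \<circ> (\<lambda>n. (0, 0, n, 0)))"
definition "\<tau>\<^sub>4 = (fst \<circ> snd) \<circ> (\<Theta> \<circ> (\<lambda>b. (0, 0, 0, b)))"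
definition "\<nu>\<^sub>1 = (fst \<circ> snd \<circ> snd) \<circ> (\<Theta> \<circ> (\<lambda>a. (a, 0, 0, 0)))"
definition "\<nu>\<^sub>2 = (fst \<circ> snd \<circ> snd) \<circ> (\<Theta> \<circ> (\<lambda>m. (0, m, 0, 0)))"
definition "\<nu>\<^sub>3 = (fst \<circ> snd \<circ> snd) \<circ> (\<Theta> \<circ> (\<lambda>n. (0, 0, n, 0)))"
definition "\<nu>\<^sub>4 = (fst \<circ> snd \<circ> snd) \<circ> (\<Theta> \<circ> (\<lambda>b. (0, 0, 0, b)))"
definition "\<mu>\<^sub>1 = (snd \<circ> snd \<circ> snd) \<circ> (\<Theta> \<circ> (\<lambda>a. (a, 0, 0, 0)))"
definition "\<mu>\<^sub>2 = (snd \<circ> snd \<circ> snd) \<circ> (\<Theta> \<circ> (\<lambda>m. (0, m, 0, 0)))"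
definition "\<mu>\<^sub>3 = (snd \<circ> snd \<circ> snd) \<circ> (\<Theta> \<circ> (\<lambda>n. (0, 0, n, 0)))"
definition "\<mu>\<^sub>4 = (snd \<circ> snd \<circ> snd) \<circ> (\<Theta> \<circ> (\<lambda>b. (0, 0, 0, b)))"

lemmas entry_defs =
  \<delta>\<^sub>1_def \<delta>\<^sub>2_def \<delta>\<^sub>3_def \<delta>\<^sub>4_def \<tau>\<^sub>1_def \<tau>\<^sub>2_def \<tau>\<^sub>3_def \<tau>\<^sub>4_def
  \<nu>\<^sub>1_def \<nu>\<^sub>2_def \<nu>\<^sub>3_def \<nu>\<^sub>4_def \<mu>\<^sub>1_def \<mu>\<^sub>2_def \<mu>\<^sub>3_def \<mu>\<^sub>4_def

lemma hom: "module_hom gscale gscale \<Theta>"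
  and iter_zero: "iter_comm gmul k (\<Theta> x) x = 0"
  using comm unfolding k_commuting_def by blast+

lemma entry_hom:
  "module_hom sA sA \<delta>\<^sub>1" "module_hom sM sA \<delta>\<^sub>2" "module_hom sN sA \<delta>\<^sub>3" "module_hom sB sA \<delta>\<^sub>4"
  "module_hom sA sM \<tau>\<^sub>1" "module_hom sM sM \<tau>\<^sub>2" "module_hom sN sM \<tau>\<^sub>3" "module_hom sB sM \<tau>\<^sub>4"
  "module_hom sA sN \<nu>\<^sub>1" "module_hom sM sN \<nu>\<^sub>2" "module_hom sN sN \<nu>\<^sub>3" "module_hom sB sN \<nu>\<^sub>4"
  "module_hom sA sB \<mu>\<^sub>1" "module_hom sM sB \<mu>\<^sub>2" "module_hom sN sB \<mu>\<^sub>3" "module_hom sB sB \<mu>\<^sub>4"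
  unfolding entry_defs
  by (intro module_hom_compose[OF module_hom_compose[OF _ hom]]
      module_hom_injections module_hom_projections)+

lemmas entry_add = entry_hom[THEN module_hom.add]
lemmas entry_zero [simp] = entry_hom[THEN module_hom.zero]

lemma \<Theta>_entries:
  "\<Theta> (a, m, n, b) =
    (\<delta>\<^sub>1 a + \<delta>\<^sub>2 m + \<delta>\<^sub>3 n + \<delta>\<^sub>4 b, \<tau>\<^sub>1 a + \<tau>\<^sub>2 m + \<tau>\<^sub>3 n + \<tau>\<^sub>4 b,
     \<nu>\<^sub>1 a + \<nu>\<^sub>2 m + \<nu>\<^sub>3 n + \<nu>\<^sub>4 b, \<mu>\<^sub>1 a + \<mu>\<^sub>2 m + \<mu>\<^sub>3 n + \<mu>\<^sub>4 b)"
proof -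
  have "\<Theta> (a, m, n, b) = \<Theta> ((a, 0, 0, 0) + (0, m, 0, 0) + (0, 0, n, 0) + (0, 0, 0, b))"
    by simp
  also have "\<dots> = \<Theta> (a, 0, 0, 0) + \<Theta> (0, m, 0, 0) + \<Theta> (0, 0, n, 0) + \<Theta> (0, 0, 0, b)"
    by (simp only: module_hom.add[OF hom])
  finally show ?thesis by (simp add: entry_defs prod_eq_iff)
qed

section \<open>Vanishing of the off-diagonal entries at diagonal arguments\<close>

lemma corner_left_zero:
  "iter_comm (*) k (\<delta>\<^sub>1 a) a = 0" "((\<lambda>t. - lM a t) ^^ k) (\<tau>\<^sub>1 a) = 0"
  "((\<lambda>v. rN v a) ^^ k) (\<nu>\<^sub>1 a) = 0"
  using iter_zero[of "(a, 0, 0, 0)"]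
  by (simp_all add: \<Theta>_entries iter_comm_corner_left zero_prod_def)

lemma corner_right_zero:
  "iter_comm (*) k (\<mu>\<^sub>4 b) b = 0" "((\<lambda>t. rM t b) ^^ k) (\<tau>\<^sub>4 b) = 0"
  "((\<lambda>v. - lN b v) ^^ k) (\<nu>\<^sub>4 b) = 0"
  using iter_zero[of "(0, 0, 0, b)"]
  by (simp_all add: \<Theta>_entries iter_comm_corner_right zero_prod_def)

text \<open>Needed first: it makes the off-diagonal entries invariant under shifting the argument by
  1.\<close>

lemma off_diagonal_one: "\<tau>\<^sub>1 1 = 0" "\<nu>\<^sub>1 1 = 0" "\<tau>\<^sub>4 1 = 0" "\<nu>\<^sub>4 1 = 0"
  using corner_left_zero(2,3)[of 1, THEN funpow_sign_zero]
    corner_right_zero(2,3)[of 1, THEN funpow_sign_zero]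
  by (simp_all add: M.l_one M.r_one N.l_one N.r_one)

lemma off_diagonal_zero [simp]: "\<tau>\<^sub>1 a = 0" "\<nu>\<^sub>1 a = 0" "\<tau>\<^sub>4 b = 0" "\<nu>\<^sub>4 b = 0"
proof -
  note d = entry_hom[THEN module_hom.diff] off_diagonal_one
  \<comment> \<open>The shift is chosen so that the operator \<open>f\<close> becomes
    \<open>f\<close> plus the identity: by -1 where the action carries a minus sign, by +1 in the
    other two cases.\<close>
  have "((\<lambda>t. - lM a t + t) ^^ k) (\<tau>\<^sub>1 a) = 0"
    using corner_left_zero(2)[of "a - 1"] by (simp add: d action_diff M.l_one)
  with corner_left_zero(2)[of a] show "\<tau>\<^sub>1 a = 0"
    by (rule comaximal_funpow_zero[rotated]) (simp add: M.l_add_right)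
  have "((\<lambda>v. rN v a + v) ^^ k) (\<nu>\<^sub>1 a) = 0"
    using corner_left_zero(3)[of "a + 1"] by (simp add: d entry_add N.r_add_right N.r_one)
  with corner_left_zero(3)[of a] show "\<nu>\<^sub>1 a = 0"
    by (rule comaximal_funpow_zero[rotated]) (simp add: N.r_add_left)
  have "((\<lambda>t. rM t b + t) ^^ k) (\<tau>\<^sub>4 b) = 0"
    using corner_right_zero(2)[of "b + 1"] by (simp add: d entry_add M.r_add_right M.r_one)
  with corner_right_zero(2)[of b] show "\<tau>\<^sub>4 b = 0"
    by (rule comaximal_funpow_zero[rotated]) (simp add: M.r_add_left)
  have "((\<lambda>v. - lN b v + v) ^^ k) (\<nu>\<^sub>4 b) = 0"
    using corner_right_zero(3)[of "b - 1"] by (simp add: d action_diff N.l_one)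
  with corner_right_zero(3)[of b] show "\<nu>\<^sub>4 b = 0"
    by (rule comaximal_funpow_zero[rotated]) (simp add: N.l_add_right)
qed

section \<open>Commutation with the triangular idempotents\<close>

text \<open>For \<open>(1, m, 0, 0)\<close> the \<open>N\<close> entry of the commutation gives
  \<open>\<nu>\<^sub>2 m = 0\<close> and the \<open>M\<close> entry a linear relation. For
  \<open>(0, m, 0, 1)\<close> the term \<open>\<tau>\<^sub>2 m\<close> lands on the other side, so
  the two relations can later be added or subtracted. The \<open>N\<close> side is
  symmetric.\<close>

lemma commute_at_idempotents:
  shows \<nu>\<^sub>2_zero [simp]: "\<nu>\<^sub>2 m = 0"
    and \<tau>\<^sub>3_zero [simp]: "\<tau>\<^sub>3 n = 0"
    and "lM (\<delta>\<^sub>1 1 + \<delta>\<^sub>2 m) m = \<tau>\<^sub>2 m + rM m (\<mu>\<^sub>1 1 + \<mu>\<^sub>2 m)"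
    and "lM (\<delta>\<^sub>4 1 + \<delta>\<^sub>2 m) m + \<tau>\<^sub>2 m = rM m (\<mu>\<^sub>4 1 + \<mu>\<^sub>2 m)"
    and "rN n (\<delta>\<^sub>1 1 + \<delta>\<^sub>3 n) = \<nu>\<^sub>3 n + lN (\<mu>\<^sub>1 1 + \<mu>\<^sub>3 n) n"
    and "rN n (\<delta>\<^sub>4 1 + \<delta>\<^sub>3 n) + \<nu>\<^sub>3 n = lN (\<mu>\<^sub>4 1 + \<mu>\<^sub>3 n) n"
proof -
  note s = \<Theta>_entries M.l_one M.r_one N.l_one N.r_one add_ac
  have 1: "\<Theta> (1, m, 0, 0) \<odot> (1, m, 0, 0) = (1, m, 0, 0) \<odot> \<Theta> (1, m, 0, 0)"
    by (rule idempotent_commute[OF _ iter_zero]) (simp add: s)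
  have 2: "\<Theta> (0, m, 0, 1) \<odot> (0, m, 0, 1) = (0, m, 0, 1) \<odot> \<Theta> (0, m, 0, 1)"
    by (rule idempotent_commute[OF _ iter_zero]) (simp add: s)
  have 3: "\<Theta> (1, 0, n, 0) \<odot> (1, 0, n, 0) = (1, 0, n, 0) \<odot> \<Theta> (1, 0, n, 0)"
    by (rule idempotent_commute[OF _ iter_zero]) (simp add: s)
  have 4: "\<Theta> (0, 0, n, 1) \<odot> (0, 0, n, 1) = (0, 0, n, 1) \<odot> \<Theta> (0, 0, n, 1)"
    by (rule idempotent_commute[OF _ iter_zero]) (simp add: s)
  show "\<nu>\<^sub>2 m = 0" using 1 by (simp add: s)
  show "\<tau>\<^sub>3 n = 0" using 3 by (simp add: s)
  show "lM (\<delta>\<^sub>1 1 + \<delta>\<^sub>2 m) m = \<tau>\<^sub>2 m + rM m (\<mu>\<^sub>1 1 + \<mu>\<^sub>2 m)" using 1 by (simp add: s)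
  show "lM (\<delta>\<^sub>4 1 + \<delta>\<^sub>2 m) m + \<tau>\<^sub>2 m = rM m (\<mu>\<^sub>4 1 + \<mu>\<^sub>2 m)" using 2 by (simp add: s)
  show "rN n (\<delta>\<^sub>1 1 + \<delta>\<^sub>3 n) = \<nu>\<^sub>3 n + lN (\<mu>\<^sub>1 1 + \<mu>\<^sub>3 n) n" using 3 by (simp add: s)
  show "rN n (\<delta>\<^sub>4 1 + \<delta>\<^sub>3 n) + \<nu>\<^sub>3 n = lN (\<mu>\<^sub>4 1 + \<mu>\<^sub>3 n) n" using 4 by (simp add: s)
qed

section \<open>Centrality of the diagonal entries\<close>

text \<open>With the mixed entry \<open>\<nu>\<^sub>2\<close> gone, \<Theta> keeps upper triangular
  matrices upper triangular, so \<open>iter_comm_upper\<close> applies.\<close>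

lemma upper_zero:
  "iter_comm (*) k (\<delta>\<^sub>1 a + \<delta>\<^sub>2 m + \<delta>\<^sub>4 b) a = 0"
  "iter_comm (*) k (\<mu>\<^sub>1 a + \<mu>\<^sub>2 m + \<mu>\<^sub>4 b) b = 0"
  using iter_zero[of "(a, m, 0, b)"]
    iter_comm_upper[of k "\<delta>\<^sub>1 a + \<delta>\<^sub>2 m + \<delta>\<^sub>4 b" "\<tau>\<^sub>2 m" "\<mu>\<^sub>1 a + \<mu>\<^sub>2 m + \<mu>\<^sub>4 b" a m b]
  by (auto simp: \<Theta>_entries zero_prod_def)

lemma lower_zero:
  "iter_comm (*) k (\<delta>\<^sub>1 a + \<delta>\<^sub>3 n + \<delta>\<^sub>4 b) a = 0"
  "iter_comm (*) k (\<mu>\<^sub>1 a + \<mu>\<^sub>3 n + \<mu>\<^sub>4 b) b = 0"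
  using iter_zero[of "(a, 0, n, b)"]
    iter_comm_lower[of k "\<delta>\<^sub>1 a + \<delta>\<^sub>3 n + \<delta>\<^sub>4 b" "\<nu>\<^sub>3 n" "\<mu>\<^sub>1 a + \<mu>\<^sub>3 n + \<mu>\<^sub>4 b" a n b]
  by (auto simp: \<Theta>_entries zero_prod_def)

text \<open>One diagonal argument is bracketed with while the others stay fixed; the summand
  \<open>\<delta>\<^sub>1 a\<close> or \<open>\<mu>\<^sub>4 b\<close> drops out by its own
  \<open>k\<close>-commuting identity. Only \<open>\<delta>\<^sub>3\<close> and
  \<open>\<mu>\<^sub>3\<close> need lower triangular matrices.\<close>

lemma entry_center:
  "\<delta>\<^sub>2 m \<in> k_center (*) k" "\<delta>\<^sub>3 n \<in> k_center (*) k" "\<delta>\<^sub>4 b \<in> k_center (*) k"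
  "\<mu>\<^sub>1 a \<in> k_center (*) k" "\<mu>\<^sub>2 m \<in> k_center (*) k" "\<mu>\<^sub>3 n \<in> k_center (*) k"
proof -
  note s = k_center_def iter_comm_add corner_left_zero(1) corner_right_zero(1)
  show "\<delta>\<^sub>2 m \<in> k_center (*) k" using upper_zero(1)[of _ m 0] by (simp add: s)
  show "\<delta>\<^sub>3 n \<in> k_center (*) k" using lower_zero(1)[of _ n 0] by (simp add: s)
  show "\<delta>\<^sub>4 b \<in> k_center (*) k" using upper_zero(1)[of _ 0 b] by (simp add: s)
  show "\<mu>\<^sub>1 a \<in> k_center (*) k" using upper_zero(2)[of a 0] by (simp add: s)
  show "\<mu>\<^sub>2 m \<in> k_center (*) k" using upper_zero(2)[of 0 m] by (simp add: s)
  show "\<mu>\<^sub>3 n \<in> k_center (*) k" using lower_zero(2)[of 0 n] by (simp add: s)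
qed

lemma diagonal_k_commuting: "k_commuting sA (*) k \<delta>\<^sub>1" "k_commuting sB (*) k \<mu>\<^sub>4"
  by (simp_all add: k_commuting_def entry_hom corner_left_zero(1) corner_right_zero(1))

section \<open>Sums and differences of the idempotent relations\<close>

lemma scale_two: "sM 2 m = m + m" "sN 2 n = n + n"
  using M.M.scale_left_distrib[of 1 1 m] N.M.scale_left_distrib[of 1 1 n] by simp_all

lemma idempotent_identities:
  "lM (\<delta>\<^sub>1 1 + \<delta>\<^sub>4 1 + 2 * \<delta>\<^sub>2 m) m = rM m (\<mu>\<^sub>1 1 + \<mu>\<^sub>4 1 + 2 * \<mu>\<^sub>2 m)"
  "rN n (\<delta>\<^sub>1 1 + \<delta>\<^sub>4 1 + 2 * \<delta>\<^sub>3 n) = lN (\<mu>\<^sub>1 1 + \<mu>\<^sub>4 1 + 2 * \<mu>\<^sub>3 n) n"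
  "sM 2 (\<tau>\<^sub>2 m) = lM (\<delta>\<^sub>1 1 - \<delta>\<^sub>4 1) m - rM m (\<mu>\<^sub>1 1 - \<mu>\<^sub>4 1)"
  "sN 2 (\<nu>\<^sub>3 n) = rN n (\<delta>\<^sub>1 1 - \<delta>\<^sub>4 1) - lN (\<mu>\<^sub>1 1 - \<mu>\<^sub>4 1) n"
proof -
  note s = action_simps action_diff scale_two mult_2
  \<comment> \<open>Both relations are solved for the actions of \<open>\<delta>\<^sub>1 1\<close>
    and \<open>\<delta>\<^sub>4 1\<close>; substituting these into the sum and the difference proves
    both claims about \<open>m\<close>.\<close>
  have m: "lM (\<delta>\<^sub>1 1) m = \<tau>\<^sub>2 m + rM m (\<mu>\<^sub>1 1) + rM m (\<mu>\<^sub>2 m) - lM (\<delta>\<^sub>2 m) m"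
    "lM (\<delta>\<^sub>4 1) m = rM m (\<mu>\<^sub>4 1) + rM m (\<mu>\<^sub>2 m) - \<tau>\<^sub>2 m - lM (\<delta>\<^sub>2 m) m"
    using commute_at_idempotents(3,4)[of m] by (simp_all add: s algebra_simps)
  have n: "rN n (\<delta>\<^sub>1 1) = \<nu>\<^sub>3 n + lN (\<mu>\<^sub>1 1) n + lN (\<mu>\<^sub>3 n) n - rN n (\<delta>\<^sub>3 n)"
    "rN n (\<delta>\<^sub>4 1) = lN (\<mu>\<^sub>4 1) n + lN (\<mu>\<^sub>3 n) n - \<nu>\<^sub>3 n - rN n (\<delta>\<^sub>3 n)"
    using commute_at_idempotents(5,6)[of n] by (simp_all add: s algebra_simps)
  show "lM (\<delta>\<^sub>1 1 + \<delta>\<^sub>4 1 + 2 * \<delta>\<^sub>2 m) m = rM m (\<mu>\<^sub>1 1 + \<mu>\<^sub>4 1 + 2 * \<mu>\<^sub>2 m)"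
    "sM 2 (\<tau>\<^sub>2 m) = lM (\<delta>\<^sub>1 1 - \<delta>\<^sub>4 1) m - rM m (\<mu>\<^sub>1 1 - \<mu>\<^sub>4 1)"
    by (simp_all add: s m)
  show "rN n (\<delta>\<^sub>1 1 + \<delta>\<^sub>4 1 + 2 * \<delta>\<^sub>3 n) = lN (\<mu>\<^sub>1 1 + \<mu>\<^sub>4 1 + 2 * \<mu>\<^sub>3 n) n"
    "sN 2 (\<nu>\<^sub>3 n) = rN n (\<delta>\<^sub>1 1 - \<delta>\<^sub>4 1) - lN (\<mu>\<^sub>1 1 - \<mu>\<^sub>4 1) n"
    by (simp_all add: s n)
qed

end

theorem proposition3p2:
  fixes sA :: "'r::comm_ring_1 \<Rightarrow> 'a::ring_1 \<Rightarrow> 'a"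
    and sB :: "'r \<Rightarrow> 'b::ring_1 \<Rightarrow> 'b"
    and sM :: "'r \<Rightarrow> 'm::ab_group_add \<Rightarrow> 'm"
    and sN :: "'r \<Rightarrow> 'n::ab_group_add \<Rightarrow> 'n"
    and lM :: "'a \<Rightarrow> 'm \<Rightarrow> 'm"
    and rM :: "'m \<Rightarrow> 'b \<Rightarrow> 'm"
    and lN :: "'b \<Rightarrow> 'n \<Rightarrow> 'n"
    and rN :: "'n \<Rightarrow> 'a \<Rightarrow> 'n"
    and MN :: "'m \<Rightarrow> 'n \<Rightarrow> 'a"
    and NM :: "'n \<Rightarrow> 'm \<Rightarrow> 'b"
    and \<Theta> :: "'a \<times> 'm \<times> 'n \<times> 'b \<Rightarrow> 'a \<times> 'm \<times> 'n \<times> 'b"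
    and k :: nat
  assumes "k \<ge> 2"
    and "generalized_matrix_algebra sA sB sM sN lM rM lN rN MN NM"
    and "faithful_left lM"
    and "faithful_right rM"
    and "k_commuting (gm_scale sA sM sN sB) (gm_mult lM rM lN rN MN NM) k \<Theta>"
  shows "\<exists>\<delta>\<^sub>1 \<delta>\<^sub>2 \<delta>\<^sub>3 \<delta>\<^sub>4 \<mu>\<^sub>1 \<mu>\<^sub>2 \<mu>\<^sub>3 \<mu>\<^sub>4 \<tau>\<^sub>2 \<nu>\<^sub>3.
    module_hom sA sA \<delta>\<^sub>1 \<and>
    module_hom sM sA \<delta>\<^sub>2 \<and> range \<delta>\<^sub>2 \<subseteq> k_center (*) k \<and>
    module_hom sN sA \<delta>\<^sub>3 \<and> range \<delta>\<^sub>3 \<subseteq> k_center (*) k \<and>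
    module_hom sB sA \<delta>\<^sub>4 \<and> range \<delta>\<^sub>4 \<subseteq> k_center (*) k \<and>
    module_hom sA sB \<mu>\<^sub>1 \<and> range \<mu>\<^sub>1 \<subseteq> k_center (*) k \<and>
    module_hom sM sB \<mu>\<^sub>2 \<and> range \<mu>\<^sub>2 \<subseteq> k_center (*) k \<and>
    module_hom sN sB \<mu>\<^sub>3 \<and> range \<mu>\<^sub>3 \<subseteq> k_center (*) k \<and>
    module_hom sB sB \<mu>\<^sub>4 \<and>
    module_hom sM sM \<tau>\<^sub>2 \<and>
    module_hom sN sN \<nu>\<^sub>3 \<and>
    (\<forall>a m n b. \<Theta> (a, m, n, b) =
      (\<delta>\<^sub>1 a + \<delta>\<^sub>2 m + \<delta>\<^sub>3 n + \<delta>\<^sub>4 b, \<tau>\<^sub>2 m,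
       \<nu>\<^sub>3 n, \<mu>\<^sub>1 a + \<mu>\<^sub>2 m + \<mu>\<^sub>3 n + \<mu>\<^sub>4 b)) \<and>
    k_commuting sA (*) k \<delta>\<^sub>1 \<and> \<delta>\<^sub>1 1 \<in> k_center (*) k \<and>
    k_commuting sB (*) k \<mu>\<^sub>4 \<and> \<mu>\<^sub>4 1 \<in> k_center (*) k \<and>
    (\<forall>m. lM (\<delta>\<^sub>1 1 + \<delta>\<^sub>4 1 + 2 * \<delta>\<^sub>2 m) m = rM m (\<mu>\<^sub>1 1 + \<mu>\<^sub>4 1 + 2 * \<mu>\<^sub>2 m)) \<and>
    (\<forall>n. rN n (\<delta>\<^sub>1 1 + \<delta>\<^sub>4 1 + 2 * \<delta>\<^sub>3 n) = lN (\<mu>\<^sub>1 1 + \<mu>\<^sub>4 1 + 2 * \<mu>\<^sub>3 n) n) \<and>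
    (\<forall>m. sM 2 (\<tau>\<^sub>2 m) = lM (\<delta>\<^sub>1 1 - \<delta>\<^sub>4 1) m - rM m (\<mu>\<^sub>1 1 - \<mu>\<^sub>4 1)) \<and>
    (\<forall>n. sN 2 (\<nu>\<^sub>3 n) = rN n (\<delta>\<^sub>1 1 - \<delta>\<^sub>4 1) - lN (\<mu>\<^sub>1 1 - \<mu>\<^sub>4 1) n)"
proof -
  interpret generalized_matrix_algebra sA sB sM sN lM rM lN rN MN NM by fact
  interpret gm_k_commuting sA sB sM sN lM rM lN rN MN NM \<Theta> k
    by unfold_locales fact
  show ?thesis
    \<comment> \<open>The witnesses are ten of the sixteen entry maps. The other six vanish by simp
      rules, which turns \<open>\<Theta>_entries\<close> into the required form.\<close>
    by (rule exI[of _ \<delta>\<^sub>1], rule exI[of _ \<delta>\<^sub>2], rule exI[of _ \<delta>\<^sub>3], rule exI[of _ \<delta>\<^sub>4],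
        rule exI[of _ \<mu>\<^sub>1], rule exI[of _ \<mu>\<^sub>2], rule exI[of _ \<mu>\<^sub>3], rule exI[of _ \<mu>\<^sub>4],
        rule exI[of _ \<tau>\<^sub>2], rule exI[of _ \<nu>\<^sub>3])
      (intro conjI allI image_subsetI entry_hom entry_center diagonal_k_commuting
        diagonal_k_commuting[THEN k_commuting_one] idempotent_identities,
        simp add: \<Theta>_entries)
qed

end
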